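(* Let $n\geq 1$ and let $\sigma$ be an automorphism of $\mathbb{Z}^{n}$ such that there exists an increasing chain of subgroups $$0 = M_0 \subsetneq M_1 \subsetneq \cdots \subsetneq M_r = \mathbb{Z}^{n}$$ such that each $M_i$ is stable under the action of $\sigma$, each successive quotient $M_i/M_{i-1}$ ($1 \leq i \leq r$) is free of rank at most two, and for each such quotient the automorphism induced by $\sigma$ on it is the identity map if the quotient has rank one, and is conjugate to some element of $\operatorname{GL}_2(\mathbb{Z})$ having exactly two nonzero entries if the quotient has rank two, i.e., to one of $$\begin{pmatrix}1 & 0 \\0 & 1\end{pmatrix},\begin{pmatrix}1 & 0 \\0 & -1\end{pmatrix},\begin{pmatrix}-1 & 0 \\0 & 1\end{pmatrix},\begin{pmatrix}-1 & 0 \\0 & -1\end{pmatrix},\begin{pmatrix}0 & 1 \\1 & 0\end{pmatrix},\begin{pmatrix}0 & -1 \\1 & 0\end{pmatrix},\begin{pmatrix}0 & 1 \\-1 & 0\end{pmatrix},\begin{pmatrix}0 & -1 \\-1 & 0\end{pmatrix}.$$ Then there exists a subset $A$ of $\mathbb{Z}^{n}$ such that $(A, \sigma(A))$ is a co-minimal pair in $\mathbb{Z}^n$.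
   Context: For nonempty subsets $A, B$ of an abelian group $(G,+)$, write $A + B = \{a+b \mid a\in A, b\in B\}$. The pair $(A,B)$ is called a co-minimal pair in $G$ if $A + B = G$, $A' + B \subsetneq G$ for every $\emptyset \neq A' \subsetneq A$, and $A + B' \subsetneq G$ for every $\emptyset \neq B' \subsetneq B$. Conjugate means conjugate in $\operatorname{GL}_2(\mathbb{Z})$ after choosing a basis of the rank-two quotient; that is, with respect to some $\mathbb{Z}$-basis of the quotient the induced automorphism is given by one of the listed matrices. *)

theory Defs
  imports "HOL-Analysis.Cartesian_Space" "HOL-Algebra.Free_Abelian_Groups"
begin

definition co_minimal_pair :: "('a, 'b) monoid_scheme \<Rightarrow> 'a set \<Rightarrow> 'a set \<Rightarrow> bool" where
  "co_minimal_pair G A B \<longleftrightarrow>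
     A \<subseteq> carrier G \<and> A \<noteq> {} \<and> B \<subseteq> carrier G \<and> B \<noteq> {} \<and>
     A <#>\<^bsub>G\<^esub> B = carrier G \<and>
     (\<forall>A'. A' \<noteq> {} \<and> A' \<subset> A \<longrightarrow> A' <#>\<^bsub>G\<^esub> B \<subset> carrier G) \<and>
     (\<forall>B'. B' \<noteq> {} \<and> B' \<subset> B \<longrightarrow> A <#>\<^bsub>G\<^esub> B' \<subset> carrier G)"

definition int_lattice :: "(int ^ 'n) monoid" where
  "int_lattice = \<lparr>carrier = UNIV, monoid.mult = (+), one = 0\<rparr>"

definition free_of_rank :: "('a, 'b) monoid_scheme \<Rightarrow> nat \<Rightarrow> bool" where
  "free_of_rank G k \<longleftrightarrow> free_Abelian_group {..<k} \<cong> G"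

text \<open>A \<open>\<int>\<close>-basis of an abelian group \<open>G\<close>, written multiplicatively as usual in HOL-Algebra and
  indexed by a finite type.\<close>

definition int_basis :: "('a, 'b) monoid_scheme \<Rightarrow> ('k::finite \<Rightarrow> 'a) \<Rightarrow> bool" where
  "int_basis G b \<longleftrightarrow> range b \<subseteq> carrier G \<and>
     (\<forall>x\<in>carrier G. \<exists>!c :: 'k \<Rightarrow> int. x = (\<Otimes>\<^bsub>G\<^esub>i\<in>UNIV. b i [^]\<^bsub>G\<^esub> c i))"

text \<open>Column convention: column \<open>j\<close> of \<open>T\<close> holds the coordinates of \<open>f (b j)\<close>.\<close>

definition has_matrix ::
    "('a, 'b) monoid_scheme \<Rightarrow> ('k::finite \<Rightarrow> 'a) \<Rightarrow> ('a \<Rightarrow> 'a) \<Rightarrow> int ^ 'k ^ 'k \<Rightarrow> bool" where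
  "has_matrix G b f T \<longleftrightarrow>
     (\<forall>j. f (b j) = (\<Otimes>\<^bsub>G\<^esub>i\<in>UNIV. b i [^]\<^bsub>G\<^esub> (T $ i $ j)))"

text \<open>The map induced by \<open>f\<close> on cosets of \<open>N\<close>. The sets in the union all coincide when \<open>f\<close> is an
  endomorphism with \<open>f ` N \<subseteq> N\<close>; see \<open>induced_map_coset\<close>.\<close>

definition induced_map :: "('a, 'b) monoid_scheme \<Rightarrow> ('a \<Rightarrow> 'a) \<Rightarrow> 'a set \<Rightarrow> 'a set \<Rightarrow> 'a set" where
  "induced_map G f N C = (\<Union>x\<in>C. N #>\<^bsub>G\<^esub> f x)"

lemma induced_map_coset:
  assumes G: "group G" and N: "subgroup N G" and f: "f \<in> hom G G"
    and stable: "f ` N \<subseteq> N" and x: "x \<in> carrier G"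
  shows "induced_map G f N (N #>\<^bsub>G\<^esub> x) = N #>\<^bsub>G\<^esub> f x"
proof -
  have fx: "f x \<in> carrier G"
    using hom_in_carrier[OF f x] .
  have "N #>\<^bsub>G\<^esub> f y = N #>\<^bsub>G\<^esub> f x" if y: "y \<in> N #>\<^bsub>G\<^esub> x" for y
  proof -
    from y have "\<exists>h\<in>N. y = h \<otimes>\<^bsub>G\<^esub> x"
      by (simp add: r_coset_def)
    then obtain h where h: "h \<in> N" and y: "y = h \<otimes>\<^bsub>G\<^esub> x" ..
    have hG: "h \<in> carrier G"
      using subgroup.mem_carrier[OF N h] .
    have "f y = f h \<otimes>\<^bsub>G\<^esub> f x"
      unfolding y by (rule hom_mult[OF f hG x])
    moreover have "f h \<in> N"
      using h stable by blast
    ultimately have "f y \<in> N #>\<^bsub>G\<^esub> f x"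
      unfolding r_coset_def by blast
    then show ?thesis
      using group.repr_independence[OF G _ fx N] by simp
  qed
  moreover have "x \<in> N #>\<^bsub>G\<^esub> x"
    using group.rcos_self[OF G x N] .
  ultimately show ?thesis
    unfolding induced_map_def by (metis (no_types, lifting) SUP_eq_const empty_iff)
qed

definition signed_perms2 :: "(int ^ 2 ^ 2) set" where
  "signed_perms2 =
    {vector [vector [1, 0], vector [0, 1]],   vector [vector [1, 0], vector [0, -1]],
     vector [vector [-1, 0], vector [0, 1]],  vector [vector [-1, 0], vector [0, -1]],
     vector [vector [0, 1], vector [1, 0]],   vector [vector [0, -1], vector [1, 0]],
     vector [vector [0, 1], vector [-1, 0]],  vector [vector [0, -1], vector [-1, 0]]}"

lemma signed_perms2_eq:
  "signed_perms2 = {T. invertible T \<and> card {(i, j). T $ i $ j \<noteq> 0} = 2}"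
proof (intro equalityI subsetI)
  fix T assume "T \<in> signed_perms2"
  then have T: "T$1$2 = 0 \<and> T$2$1 = 0 \<and> T$1$1 \<in> {1, -1} \<and> T$2$2 \<in> {1, -1} \<or>
      T$1$1 = 0 \<and> T$2$2 = 0 \<and> T$1$2 \<in> {1, -1} \<and> T$2$1 \<in> {1, -1}"
    unfolding signed_perms2_def by (elim insertE emptyE) simp_all
  then have "T ** transpose T = mat 1 \<and> transpose T ** T = mat 1"
    by (simp add: vec_eq_iff forall_2 matrix_matrix_mult_def sum_2 transpose_def mat_def) (elim disjE conjE; simp)
  then have "invertible T"
    unfolding invertible_def by blast
  moreover have "{(i, j). T $ i $ j \<noteq> 0} = {(1, 1), (2, 2)} \<or> {(i, j). T $ i $ j \<noteq> 0} = {(1, 2), (2, 1)}"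
    using T by (simp add: set_eq_iff forall_2) (elim disjE conjE; simp)
  then have "card {(i, j). T $ i $ j \<noteq> 0} = 2"
    by auto
  ultimately show "T \<in> {T. invertible T \<and> card {(i, j). T $ i $ j \<noteq> 0} = 2}"
    by simp
next
  fix T :: "int ^ 2 ^ 2" assume "T \<in> {T. invertible T \<and> card {(i, j). T $ i $ j \<noteq> 0} = 2}"
  then obtain S where S: "T ** S = mat 1" "S ** T = mat 1"
    and c: "card {(i, j). T $ i $ j \<noteq> 0} = 2"
    unfolding invertible_def by blast
  define a b c d where abcd: "a = T $ 1 $ 1" "b = T $ 1 $ 2" "c = T $ 2 $ 1" "d = T $ 2 $ 2"
  have S': "a * S$1$1 + b * S$2$1 = 1" "a * S$1$2 + b * S$2$2 = 0"
     "c * S$1$1 + d * S$2$1 = 0" "c * S$1$2 + d * S$2$2 = 1"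
     "S$1$1 * a + S$1$2 * c = 1" "S$2$1 * b + S$2$2 * d = 1"
    using S by (auto simp: vec_eq_iff forall_2 matrix_matrix_mult_def sum_2 mat_def abcd)
  have "{(i, j). T $ i $ j \<noteq> 0} =
      (if a = 0 then {} else {(1, 1)}) \<union> (if b = 0 then {} else {(1, 2)}) \<union>
      (if c = 0 then {} else {(2, 1)}) \<union> (if d = 0 then {} else {(2, 2)})"
    by (auto simp: set_eq_iff forall_2 abcd)
  with c have "(a = 0 \<and> d = 0 \<and> b \<noteq> 0 \<and> c \<noteq> 0) \<or> (b = 0 \<and> c = 0 \<and> a \<noteq> 0 \<and> d \<noteq> 0)"
    using S' by (auto split: if_splits)
  moreover have "b \<in> {1, -1}" "c \<in> {1, -1}" if "a = 0" "d = 0"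
    using S'(1,4) that by (simp_all add: zmult_eq_1_iff) blast+
  moreover have "a \<in> {1, -1}" "d \<in> {1, -1}" if "b = 0" "c = 0"
    using S'(1,4) that by (simp_all add: zmult_eq_1_iff) blast+
  ultimately have "(a = 0 \<and> d = 0 \<and> b \<in> {1, -1} \<and> c \<in> {1, -1}) \<or> (b = 0 \<and> c = 0 \<and> a \<in> {1, -1} \<and> d \<in> {1, -1})"
    by blast
  moreover have T: "T = vector [vector [a, b], vector [c, d]]"
    by (simp add: vec_eq_iff forall_2 abcd)
  ultimately show "T \<in> signed_perms2"
    unfolding signed_perms2_def T by (elim disjE conjE insertE emptyE) simp_all
qed

end

theory Submission
  imports Defs
begin

text \<open>
  The set \<open>A\<close> is assembled along the filtration, one quotient at a time.

  Say that a pair \<open>(A, B)\<close> is tight if \<open>A + B\<close> is the whole group and every element of \<open>A\<close> and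
  every element of \<open>B\<close> occurs in a sum \<open>a + b\<close> that has no second representation. Tight pairs are
  co-minimal, because removing an element loses its unique sum, and they pass through group
  extensions: if \<open>(A\<^sub>1, B\<^sub>1)\<close> is tight in a subgroup and \<open>(A\<^sub>2, B\<^sub>2)\<close> is tight in the quotient, lift the
  elements of \<open>A\<^sub>2\<close> and \<open>B\<^sub>2\<close> arbitrarily and add \<open>A\<^sub>1\<close>, respectively \<open>B\<^sub>1\<close>
  (\<open>tight_pair_extension\<close>). The freedom in the lifts is what accommodates the automorphism: if \<open>B\<^sub>2\<close>
  is the image of \<open>A\<^sub>2\<close> under the induced map (injective on \<open>A\<^sub>2\<close>), the lift of \<open>B\<^sub>2\<close> can be taken to be the image of the
  lift of \<open>A\<^sub>2\<close>, and then the second set is exactly the image of the first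
  (\<open>tight_pair_image_extension\<close>).

  It remains to treat each quotient. In a torsion-free abelian group the pair \<open>(X, X)\<close> is tight as soon as
  \<open>X + X\<close> is everything and no element of \<open>X\<close> is the midpoint of two others, since then \<open>x + x\<close> is
  a unique sum. A greedy construction gives such a set \<open>X\<close> of integers with the further property
  \<open>X = -X\<close> (\<open>symmetric_midpoint_free_basis\<close>). Both conditions may be checked coordinatewise, so the
  elements whose coordinates in a given basis lie in \<open>X\<close> again form such a set
  (\<open>tight_pair_lin_combs\<close>). A signed permutation matrix maps this set onto itself because
  \<open>X = -X\<close>, and this one set serves all eight matrices, as well as the identity in rank one.
\<close>

section \<open>A symmetric additive basis of the integers without midpoints\<close>

definition midpoint_free :: "int set \<Rightarrow> bool" where
  "midpoint_free X \<longleftrightarrow> (\<forall>u\<in>X. \<forall>v\<in>X. \<forall>w\<in>X. u + v = 2 * w \<longrightarrow> u = w)"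

text \<open>
  To represent a new integer \<open>z\<close> as a sum, adjoin \<open>a\<close> and \<open>z - a\<close> together with their negatives, for
  \<open>a\<close> much larger than \<open>z\<close> and all old elements. In an equation \<open>u + v = 2 * w\<close> the multiples of \<open>a\<close>
  must then cancel. If \<open>w\<close> is old, either all three are old or \<open>u + v\<close> is one of \<open>0\<close>, \<open>z\<close>, \<open>-z\<close>,
  which is impossible: \<open>0\<close> is excluded from the set, and \<open>z\<close> or \<open>-z\<close> being \<open>w + w\<close> would make \<open>z\<close> an
  old sum. If \<open>w\<close> is new, \<open>u\<close> and \<open>v\<close> lie in the same cluster \<open>{a, a - z}\<close> or \<open>{-a, z - a}\<close> as \<open>w\<close>,
  and two distinct points have no midpoint among themselves; they are distinct as \<open>z \<noteq> 0\<close>.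
\<close>

lemma extend_symmetric_midpoint_free:
  fixes F :: "int set" and z :: int
  assumes "finite F" "uminus ` F \<subseteq> F" "0 \<notin> F" "midpoint_free F" "F \<noteq> {}"
  obtains F' where "F \<subseteq> F'" "finite F'" "uminus ` F' \<subseteq> F'" "0 \<notin> F'" "midpoint_free F'"
    "\<exists>u\<in>F'. \<exists>v\<in>F'. z = u + v"
proof (cases "\<exists>u\<in>F. \<exists>v\<in>F. z = u + v")
  case True
  with assms that[of F] show ?thesis by blast
next
  case new: False
  obtain m where m: "\<And>x. x \<in> F \<Longrightarrow> \<bar>x\<bar> \<le> m"
    using \<open>finite F\<close> by (metis finite_imageI Max_ge imageI)
  have neg: "- x \<in> F" if "x \<in> F" for x
    using that assms(2) by blast
  have "z \<noteq> 0"
    using new \<open>F \<noteq> {}\<close> neg by (metis add.right_inverse ex_in_conv)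
  have "m \<ge> 0"
    using m \<open>F \<noteq> {}\<close> by force
  have mid: "2 * w \<noteq> z" "2 * w \<noteq> - z" if "w \<in> F" for w
    using new that neg by (metis mult_2, metis add_uminus_conv_diff diff_minus_eq_add
        minus_add_distrib minus_equation_iff mult_2)
  \<comment> \<open>The factor 4 makes \<open>a - k\<close> exceed \<open>3 * m\<close>, and makes \<open>2 * (a - k)\<close> exceed \<open>m + a + k\<close>: a new
    element never balances against two old ones, nor twice a new element against a sum with an
    old one.\<close>
  define k where "k = \<bar>z\<bar>"
  have k: "- k \<le> z" "z \<le> k" "0 \<le> k" unfolding k_def by auto
  define a where "a = 4 * m + 4 * k + 1"
  define N where "N = {a, - a, a - z, z - a}"
  have mfF: "u = w" if "u \<in> F" "v \<in> F" "w \<in> F" "u + v = 2 * w" for u v w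
    using assms(4) that unfolding midpoint_free_def by blast
  have N_bounds: "a - k \<le> \<bar>x\<bar>" "\<bar>x\<bar> \<le> a + k" if "x \<in> N" for x
    using that \<open>m \<ge> 0\<close> k unfolding N_def a_def by auto
  have mf: "u = w" if u: "u \<in> F \<union> N" and v: "v \<in> F \<union> N" and w: "w \<in> F \<union> N"
    and eq: "u + v = 2 * w" for u v w
  proof (cases "w \<in> F")
    case True
    have "w \<noteq> 0" using True assms(3) by blast
    have "\<not> (u \<in> N \<and> v \<in> N)"
    proof
      assume "u \<in> N \<and> v \<in> N"
      then have "u + v \<in> {0, z, - z, 2 * a, 2 * a - z, 2 * a - 2 * z, - 2 * a, z - 2 * a, 2 * z - 2 * a}"
        unfolding N_def by (elim conjE insertE emptyE; simp)
      moreover have "- m \<le> w" "w \<le> m" using m[OF True] by auto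
      moreover have "2 * w \<notin> {0, z, - z}"
        using \<open>w \<noteq> 0\<close> mid[OF True] by simp
      ultimately show False
        using eq k unfolding a_def by (elim insertE emptyE; (simp; fail | linarith))
    qed
    moreover have "y \<notin> N" if "x \<in> F" "x + y = 2 * w" for x y
    proof
      assume "y \<in> N"
      then have "a - k \<le> \<bar>y\<bar>" by (rule N_bounds)
      moreover have "\<bar>y\<bar> \<le> 3 * m"
        using m[OF True] m[OF that(1)] that(2) by linarith
      ultimately show False
        using \<open>m \<ge> 0\<close> k(3) unfolding a_def by linarith
    qed
    then have "\<not> (u \<in> F \<and> v \<in> N)" "\<not> (u \<in> N \<and> v \<in> F)"
      using eq by (metis add.commute)+
    ultimately show ?thesis
      using u v True eq mfF by blast
  next
    case False
    then have wN: "w \<in> N" using w by blast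
    have "x \<notin> F" if "y \<in> F \<union> N" "x + y = 2 * w" for x y
    proof
      assume "x \<in> F"
      have "\<bar>y\<bar> \<le> a + k"
        using that(1) m[of y] N_bounds(2)[of y] \<open>m \<ge> 0\<close> k(3) unfolding a_def by auto
      then have "2 * \<bar>w\<bar> \<le> m + a + k"
        using m[OF \<open>x \<in> F\<close>] that(2) by linarith
      then show False
        using N_bounds(1)[OF wN] \<open>m \<ge> 0\<close> k(3) unfolding a_def by linarith
    qed
    then have "u \<in> N" "v \<in> N"
      using u v eq by (metis UnE add.commute)+
    moreover have "z < 0 \<or> z > 0" using \<open>z \<noteq> 0\<close> by linarith
    moreover have "a > 4 * k" using \<open>m \<ge> 0\<close> unfolding a_def by linarith
    ultimately show ?thesis
      using wN eq k unfolding N_def by (elim disjE insertE emptyE; linarith)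
  qed
  show ?thesis
  proof (rule that[of "F \<union> N"])
    show "midpoint_free (F \<union> N)"
      using mf unfolding midpoint_free_def by blast
    show "0 \<notin> F \<union> N"
      using assms(3) \<open>m \<ge> 0\<close> k unfolding N_def a_def by auto
    show "\<exists>u\<in>F \<union> N. \<exists>v\<in>F \<union> N. z = u + v"
      unfolding N_def by (rule bexI[of _ a], rule bexI[of _ "z - a"]) auto
  qed (use assms in \<open>auto simp: N_def\<close>)
qed

text \<open>
  Enumerate the integers and take the union of the chain of finite extensions that represent them
  one after another. The starting set \<open>{1, -1}\<close> is nonempty and avoids \<open>0\<close>, so that \<open>0 = 1 + (-1)\<close> is
  represented from the outset and every further \<open>z\<close> to be added is nonzero.
\<close>

lemma symmetric_midpoint_free_basis:
  obtains X :: "int set" where "uminus ` X = X" "midpoint_free X" "\<And>z. \<exists>u\<in>X. \<exists>v\<in>X. z = u + v"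
proof -
  define P where "P F \<longleftrightarrow> finite F \<and> F \<noteq> {} \<and> uminus ` F \<subseteq> F \<and> 0 \<notin> F \<and> midpoint_free F" for F :: "int set"
  have "\<exists>F. \<forall>n. P (F n) \<and>
      (F n \<subseteq> F (Suc n) \<and> (\<exists>u\<in>F (Suc n). \<exists>v\<in>F (Suc n). from_nat n = u + v))"
  proof (rule dependent_nat_choice)
    show "\<exists>F. P F"
      by (rule exI[of _ "{1, -1}"]) (auto simp: P_def midpoint_free_def)
  next
    fix F n assume "P F"
    then show "\<exists>F'. P F' \<and> (F \<subseteq> F' \<and> (\<exists>u\<in>F'. \<exists>v\<in>F'. from_nat n = u + v))"
      unfolding P_def by (metis extend_symmetric_midpoint_free subset_empty)
  qed
  then obtain F where P: "\<And>n. P (F n)" and sub: "\<And>n. F n \<subseteq> F (Suc n)"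
    and cover: "\<And>n. \<exists>u\<in>F (Suc n). \<exists>v\<in>F (Suc n). from_nat n = u + v"
    by blast
  have mono: "F i \<subseteq> F j" if "i \<le> j" for i j
    using that sub by (rule lift_Suc_mono_le[rotated])
  show ?thesis
  proof (rule that[of "\<Union>n. F n"])
    show "midpoint_free (\<Union>n. F n)"
      unfolding midpoint_free_def
    proof clarify
      fix u v w i j k assume *: "u \<in> F i" "v \<in> F j" "w \<in> F k" "u + v = 2 * w"
      define p where "p = max i (max j k)"
      have "i \<le> p" "j \<le> p" "k \<le> p" unfolding p_def by auto
      then have "u \<in> F p" "v \<in> F p" "w \<in> F p"
        using * mono by blast+
      then show "u = w"
        using P[of p] \<open>u + v = 2 * w\<close> unfolding P_def midpoint_free_def by blast
    qed
    show "uminus ` (\<Union>n. F n) = (\<Union>n. F n)"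
    proof
      show *: "uminus ` (\<Union>n. F n) \<subseteq> (\<Union>n. F n)"
        using P unfolding P_def by blast
      show "(\<Union>n. F n) \<subseteq> uminus ` (\<Union>n. F n)"
        using image_mono[OF *, of uminus] by (simp add: image_image)
    qed
    fix z :: int
    show "\<exists>u\<in>(\<Union>n. F n). \<exists>v\<in>(\<Union>n. F n). z = u + v"
      using cover[of "to_nat z"] unfolding from_nat_to_nat by blast
  qed
qed

section \<open>Pairs in which every element has a unique sum\<close>

text \<open>
  Tightness is a pointwise witness form of co-minimality: instead of quantifying over proper subsets
  it names, for each element, a product that would be lost with it. In this form the condition can
  be transported through extensions.
\<close>

definition sole_product :: "('a, 'b) monoid_scheme \<Rightarrow> 'a set \<Rightarrow> 'a set \<Rightarrow> 'a \<Rightarrow> 'a \<Rightarrow> bool" where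
  "sole_product G A B a b \<longleftrightarrow> a \<in> A \<and> b \<in> B \<and>
     (\<forall>a'\<in>A. \<forall>b'\<in>B. a' \<otimes>\<^bsub>G\<^esub> b' = a \<otimes>\<^bsub>G\<^esub> b \<longrightarrow> a' = a \<and> b' = b)"

definition tight_pair :: "('a, 'b) monoid_scheme \<Rightarrow> 'a set \<Rightarrow> 'a set \<Rightarrow> bool" where
  "tight_pair G A B \<longleftrightarrow> A \<subseteq> carrier G \<and> B \<subseteq> carrier G \<and>
     (\<forall>g\<in>carrier G. \<exists>a\<in>A. \<exists>b\<in>B. g = a \<otimes>\<^bsub>G\<^esub> b) \<and>
     (\<forall>a\<in>A. \<exists>b. sole_product G A B a b) \<and> (\<forall>b\<in>B. \<exists>a. sole_product G A B a b)"

lemma tight_pair_imp_co_minimal_pair: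
  fixes G (structure)
  assumes "monoid G" and tight: "tight_pair G A B"
  shows "co_minimal_pair G A B"
proof -
  interpret monoid G by fact
  have sub: "A \<subseteq> carrier G" "B \<subseteq> carrier G"
    and cover: "\<And>g. g \<in> carrier G \<Longrightarrow> \<exists>a\<in>A. \<exists>b\<in>B. g = a \<otimes>\<^bsub>G\<^esub> b"
    and soleA: "\<And>a. a \<in> A \<Longrightarrow> \<exists>b. sole_product G A B a b"
    and soleB: "\<And>b. b \<in> B \<Longrightarrow> \<exists>a. sole_product G A B a b"
    using tight unfolding tight_pair_def by auto
  have prods: "A' <#> B' \<subseteq> carrier G" if "A' \<subseteq> A" "B' \<subseteq> B" for A' B'
    using that sub unfolding set_mult_def by blast
  have "A' <#> B \<subset> carrier G" if A': "A' \<subset> A" for A'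
  proof -
    obtain a where a: "a \<in> A" "a \<notin> A'" using A' by blast
    obtain b where sole: "sole_product G A B a b" using soleA a by blast
    have "a \<otimes>\<^bsub>G\<^esub> b \<notin> A' <#> B"
    proof
      assume "a \<otimes>\<^bsub>G\<^esub> b \<in> A' <#> B"
      then obtain a' b' where "a' \<in> A'" "b' \<in> B" "a' \<otimes>\<^bsub>G\<^esub> b' = a \<otimes>\<^bsub>G\<^esub> b"
        unfolding set_mult_def by auto
      then have "a' = a" "a' \<in> A'"
        using sole A' unfolding sole_product_def by blast+
      then show False using a by simp
    qed
    moreover have "a \<otimes>\<^bsub>G\<^esub> b \<in> carrier G"
      using sole sub unfolding sole_product_def by blast
    ultimately show ?thesis using prods[of A' B] A' by blast
  qed
  moreover have "A <#> B' \<subset> carrier G" if B': "B' \<subset> B" for B'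
  proof -
    obtain b where b: "b \<in> B" "b \<notin> B'" using B' by blast
    obtain a where sole: "sole_product G A B a b" using soleB b by blast
    have "a \<otimes>\<^bsub>G\<^esub> b \<notin> A <#> B'"
    proof
      assume "a \<otimes>\<^bsub>G\<^esub> b \<in> A <#> B'"
      then obtain a' b' where "a' \<in> A" "b' \<in> B'" "a' \<otimes>\<^bsub>G\<^esub> b' = a \<otimes>\<^bsub>G\<^esub> b"
        unfolding set_mult_def by auto
      then have "b' = b" "b' \<in> B'"
        using sole B' unfolding sole_product_def by blast+
      then show False using b by simp
    qed
    moreover have "a \<otimes>\<^bsub>G\<^esub> b \<in> carrier G"
      using sole sub unfolding sole_product_def by blast
    ultimately show ?thesis using prods[of A B'] B' by blast
  qed
  moreover have "A <#> B = carrier G"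
  proof (rule subset_antisym)
    show "A <#> B \<subseteq> carrier G" by (rule prods) auto
    show "carrier G \<subseteq> A <#> B"
      using cover unfolding set_mult_def by fast
  qed
  moreover have "A \<noteq> {}" "B \<noteq> {}"
    using cover[OF one_closed] by auto
  ultimately show ?thesis
    using sub unfolding co_minimal_pair_def by simp
qed

section \<open>Group extensions\<close>

lemma (in comm_group) comm_group_subgroup:
  assumes H: "subgroup H G"
  shows "comm_group (G\<lparr>carrier := H\<rparr>)"
  by (rule group.group_comm_groupI[OF subgroup_imp_group[OF H]])
    (use subgroup.subset[OF H] in \<open>auto intro!: m_comm\<close>)

text \<open>
  If \<open>a \<otimes> b\<close> is a sole product in \<open>N\<close> and \<open>c\<close>, \<open>d\<close> have a sole product in the quotient, then
  \<open>(s c \<otimes> a) \<otimes> (t d \<otimes> b)\<close> is a sole product in \<open>G\<close>: its coset determines \<open>c\<close> and \<open>d\<close>, and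
  after cancelling the common lifts \<open>s c \<otimes> t d\<close> only an equation in \<open>N\<close> is left.
  The same rearrangement gives the covering, since a coset \<open>c <#> d\<close> is the translate of
  \<open>N\<close> by \<open>s c \<otimes> t d\<close>. Commutativity is what lets the lifts be collected on one side.
\<close>

lemma (in comm_group) tight_pair_extension:
  assumes N: "subgroup N G"
    and tight1: "tight_pair (G\<lparr>carrier := N\<rparr>) AN BN"
    and tight2: "tight_pair (G Mod N) AQ BQ"
    and s: "\<And>c. c \<in> AQ \<Longrightarrow> s c \<in> c" and t: "\<And>d. d \<in> BQ \<Longrightarrow> t d \<in> d"
  shows "tight_pair G {s c \<otimes> a | c a. c \<in> AQ \<and> a \<in> AN} {t d \<otimes> b | d b. d \<in> BQ \<and> b \<in> BN}"
    (is "tight_pair G ?A ?B")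
proof -
  interpret N: normal N G using N by (rule subgroup_imp_normal)
  have sub1: "AN \<subseteq> N" "BN \<subseteq> N"
    and cover1: "\<And>g. g \<in> N \<Longrightarrow> \<exists>a\<in>AN. \<exists>b\<in>BN. g = a \<otimes> b"
    and sole1A: "\<And>a. a \<in> AN \<Longrightarrow> \<exists>b. sole_product (G\<lparr>carrier := N\<rparr>) AN BN a b"
    and sole1B: "\<And>b. b \<in> BN \<Longrightarrow> \<exists>a. sole_product (G\<lparr>carrier := N\<rparr>) AN BN a b"
    using tight1 unfolding tight_pair_def by auto
  have sub2: "AQ \<subseteq> rcosets N" "BQ \<subseteq> rcosets N"
    and cover2: "\<And>g. g \<in> rcosets N \<Longrightarrow> \<exists>a\<in>AQ. \<exists>b\<in>BQ. g = a <#> b"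
    and sole2A: "\<And>a. a \<in> AQ \<Longrightarrow> \<exists>b. sole_product (G Mod N) AQ BQ a b"
    and sole2B: "\<And>b. b \<in> BQ \<Longrightarrow> \<exists>a. sole_product (G Mod N) AQ BQ a b"
    using tight2 unfolding tight_pair_def by (auto simp: FactGroup_def)
  have rep: "x \<in> carrier G \<and> N #> x = C" if "C \<in> rcosets N" "x \<in> C" for C x
    using that repr_independence[OF _ _ N] N.rcosets_carrier[OF is_group]
    unfolding RCOSETS_def by blast
  have sG: "s c \<in> carrier G" "N #> s c = c" if "c \<in> AQ" for c
    using that sub2 s rep by blast+
  have tG: "t d \<in> carrier G" "N #> t d = d" if "d \<in> BQ" for d
    using that sub2 t rep by blast+
  have NG: "x \<in> carrier G" if "x \<in> N" for x
    using that N.subset by blast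
  have rearrange: "(x \<otimes> a) \<otimes> (y \<otimes> b) = (a \<otimes> b) \<otimes> (x \<otimes> y)"
    if "x \<in> carrier G" "y \<in> carrier G" "a \<in> carrier G" "b \<in> carrier G" for x y a b
    using that by (simp add: m_ac)
  have coset: "N #> ((s c \<otimes> a) \<otimes> (t d \<otimes> b)) = c <#> d"
    if "c \<in> AQ" "d \<in> BQ" "a \<in> AN" "b \<in> BN" for a b c d
  proof -
    have ab: "a \<otimes> b \<in> N" using that sub1 by auto
    have "N #> ((s c \<otimes> a) \<otimes> (t d \<otimes> b)) = N #> ((a \<otimes> b) \<otimes> (s c \<otimes> t d))"
      using that sG tG sub1 NG by (subst rearrange) auto
    also have "\<dots> = (N #> (a \<otimes> b)) #> (s c \<otimes> t d)"
      using that sG tG ab NG N.subset by (subst coset_mult_assoc) auto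
    also have "\<dots> = N #> (s c \<otimes> t d)"
      using coset_join2[OF NG[OF ab] N ab] by simp
    also have "\<dots> = (N #> s c) <#> (N #> t d)"
      using that sG(1) tG(1) by (intro N.rcos_sum[symmetric]) auto
    finally show ?thesis
      unfolding sG(2)[OF that(1)] tG(2)[OF that(2)] .
  qed
  have sole: "sole_product G ?A ?B (s c \<otimes> a) (t d \<otimes> b)"
    if ab: "sole_product (G\<lparr>carrier := N\<rparr>) AN BN a b" and cd: "sole_product (G Mod N) AQ BQ c d"
    for a b c d
  proof -
    have mem: "a \<in> AN" "b \<in> BN" "c \<in> AQ" "d \<in> BQ"
      using ab cd unfolding sole_product_def by auto
    have "c' = c \<and> d' = d \<and> a' = a \<and> b' = b"
      if mem': "c' \<in> AQ" "a' \<in> AN" "d' \<in> BQ" "b' \<in> BN"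
        and eq: "(s c' \<otimes> a') \<otimes> (t d' \<otimes> b') = (s c \<otimes> a) \<otimes> (t d \<otimes> b)" for a' b' c' d'
    proof -
      have car: "s c \<in> carrier G" "t d \<in> carrier G" "a \<in> carrier G" "b \<in> carrier G"
        "a' \<in> carrier G" "b' \<in> carrier G"
        using mem mem' sG(1) tG(1) sub1 NG by blast+
      have "c' <#> d' = c <#> d"
        using coset[of c' d' a' b'] coset[of c d a b] mem mem' eq by simp
      then have cd': "c' = c" "d' = d"
        using cd mem' unfolding sole_product_def by (auto simp: FactGroup_def)
      have "(a' \<otimes> b') \<otimes> (s c \<otimes> t d) = (a \<otimes> b) \<otimes> (s c \<otimes> t d)"
        using eq unfolding cd' by (simp add: rearrange car)
      then have "a' \<otimes> b' = a \<otimes> b"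
        by (simp add: car)
      then show ?thesis
        using ab cd' mem' unfolding sole_product_def by simp
    qed
    then show ?thesis
      using mem unfolding sole_product_def by blast
  qed
  have subs: "?A \<subseteq> carrier G" "?B \<subseteq> carrier G"
    using sG tG sub1 NG by auto
  have cover: "\<exists>x\<in>?A. \<exists>y\<in>?B. g = x \<otimes> y" if g: "g \<in> carrier G" for g
  proof -
    have "N #> g \<in> rcosets N" using g N.subset by (rule rcosetsI[rotated])
    then obtain c d where cd: "c \<in> AQ" "d \<in> BQ" "N #> g = c <#> d"
      using cover2 by blast
    then have "N #> g = N #> (s c \<otimes> t d)"
      using sG tG by (metis N.rcos_sum)
    then have "g \<in> N #> (s c \<otimes> t d)"
      using rcos_self[OF g N] by simp
    then obtain n where n: "n \<in> N" "g = n \<otimes> (s c \<otimes> t d)"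
      unfolding r_coset_def by blast
    obtain a b where ab: "a \<in> AN" "b \<in> BN" "n = a \<otimes> b"
      using cover1 n by blast
    have "g = (s c \<otimes> a) \<otimes> (t d \<otimes> b)"
      using n ab cd sG tG sub1 NG by (subst rearrange) auto
    then show ?thesis using ab cd by blast
  qed
  have soleA: "\<exists>y. sole_product G ?A ?B x y" if x: "x \<in> ?A" for x
  proof -
    obtain c a where ca: "c \<in> AQ" "a \<in> AN" "x = s c \<otimes> a" using x by blast
    obtain b d where "sole_product (G\<lparr>carrier := N\<rparr>) AN BN a b" "sole_product (G Mod N) AQ BQ c d"
      using sole1A[OF ca(2)] sole2A[OF ca(1)] by blast
    then show ?thesis unfolding ca(3) by (intro exI) (rule sole)
  qed
  have soleB: "\<exists>x. sole_product G ?A ?B x y" if y: "y \<in> ?B" for y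
  proof -
    obtain d b where db: "d \<in> BQ" "b \<in> BN" "y = t d \<otimes> b" using y by blast
    obtain a c where "sole_product (G\<lparr>carrier := N\<rparr>) AN BN a b" "sole_product (G Mod N) AQ BQ c d"
      using sole1B[OF db(2)] sole2B[OF db(1)] by blast
    then show ?thesis unfolding db(3) by (intro exI) (rule sole)
  qed
  show ?thesis
    unfolding tight_pair_def by (intro conjI ballI subs cover soleA soleB)
qed

text \<open>
  Given a lift \<open>s\<close> of \<open>AQ\<close>, an element of \<open>F ` AQ\<close> is lifted by applying \<open>f \<circ> s\<close> to its
  preimage. Injectivity of \<open>F\<close> on \<open>AQ\<close> makes the preimage unique, so that the second set
  produced by the extension is the image of the first under \<open>f\<close>.
\<close>

lemma (in comm_group) tight_pair_image_extension:
  assumes N: "subgroup N G" and f: "f \<in> hom G G" and stable: "f ` N \<subseteq> N"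
    and tight1: "tight_pair (G\<lparr>carrier := N\<rparr>) AN (f ` AN)"
    and tight2: "tight_pair (G Mod N) AQ (F ` AQ)"
    and F: "\<And>x. x \<in> carrier G \<Longrightarrow> F (N #> x) = N #> f x"
    and inj: "inj_on F AQ"
  shows "\<exists>A. tight_pair G A (f ` A)"
proof -
  interpret N: normal N G using N by (rule subgroup_imp_normal)
  define s where "s c = (SOME x. x \<in> c)" for c :: "'a set"
  define t where "t d = f (s (inv_into AQ F d))" for d
  have AQ: "AQ \<subseteq> rcosets N" and AN: "AN \<subseteq> N"
    using tight1 tight2 unfolding tight_pair_def by (auto simp: FactGroup_def)
  have s: "s c \<in> c \<and> s c \<in> carrier G \<and> N #> s c = c" if c: "c \<in> AQ" for c
  proof -
    obtain x where x: "x \<in> carrier G" "c = N #> x"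
      using c AQ unfolding RCOSETS_def by blast
    have "s c \<in> c"
      unfolding s_def by (rule someI[of _ x]) (use x rcos_self[OF _ N] in simp)
    then show ?thesis
      using x N repr_independence[of "s c" N x] N.elemrcos_carrier[OF is_group] c AQ by blast
  qed
  have ts: "t (F c) = f (s c)" if "c \<in> AQ" for c
    unfolding t_def using that inj by simp
  have t: "t d \<in> d" if d: "d \<in> F ` AQ" for d
  proof -
    obtain c where c: "c \<in> AQ" "d = F c" using d by blast
    have "d = N #> f (s c)" using c F s by metis
    moreover have "f (s c) \<in> carrier G"
      using c s hom_in_carrier[OF f] by blast
    moreover have "t d = f (s c)" using ts c by simp
    ultimately show ?thesis
      using rcos_self[OF _ N] by metis
  qed
  let ?A = "{s c \<otimes> a | c a. c \<in> AQ \<and> a \<in> AN}"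
  have fsa: "f (s c \<otimes> a) = t (F c) \<otimes> f a" if "c \<in> AQ" "a \<in> AN" for c a
    using that s AN N.subset ts hom_mult[OF f] by (metis subsetD)
  have "f ` ?A = {t d \<otimes> b | d b. d \<in> F ` AQ \<and> b \<in> f ` AN}" (is "_ = ?B")
  proof
    show "f ` ?A \<subseteq> ?B" using fsa by blast
    show "?B \<subseteq> f ` ?A" by (smt (verit, best) fsa image_iff mem_Collect_eq subsetI)
  qed
  then show ?thesis
    using tight_pair_extension[OF N tight1 tight2, of s t] s t by metis
qed

section \<open>Groups with a finite basis\<close>

definition lin_comb :: "('a, 'b) monoid_scheme \<Rightarrow> ('k::finite \<Rightarrow> 'a) \<Rightarrow> ('k \<Rightarrow> int) \<Rightarrow> 'a" where
  "lin_comb G b c = (\<Otimes>\<^bsub>G\<^esub>i\<in>UNIV. b i [^]\<^bsub>G\<^esub> c i)"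

lemma (in comm_group)
  assumes "range b \<subseteq> carrier G"
  shows lin_comb_closed: "lin_comb G b c \<in> carrier G"
    and lin_comb_add: "lin_comb G b c \<otimes> lin_comb G b d = lin_comb G b (\<lambda>i. c i + d i)"
proof -
  have b: "b i \<in> carrier G" for i using assms by blast
  show "lin_comb G b c \<in> carrier G"
    unfolding lin_comb_def using b by (intro finprod_closed) auto
  show "lin_comb G b c \<otimes> lin_comb G b d = lin_comb G b (\<lambda>i. c i + d i)"
    unfolding lin_comb_def using b
    by (subst finprod_multf[symmetric]) (auto simp: int_pow_mult)
qed

lemma int_basis_lin_comb:
  "int_basis G b \<longleftrightarrow> range b \<subseteq> carrier G \<and> (\<forall>x\<in>carrier G. \<exists>!c. x = lin_comb G b c)"
  unfolding int_basis_def lin_comb_def ..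

lemma (in comm_group) inj_lin_comb:
  assumes "int_basis G b"
  shows "inj (lin_comb G b)"
  using assms lin_comb_closed unfolding int_basis_lin_comb inj_on_def by metis

text \<open>
  For every \<open>x \<in> A\<close> the product \<open>x \<otimes> x\<close> is the sole one: comparing coordinates in
  \<open>u \<otimes> v = x \<otimes> x\<close> makes each coordinate of \<open>x\<close> the midpoint of two elements of \<open>X\<close>.
\<close>

lemma (in comm_group) tight_pair_lin_combs:
  assumes basis: "int_basis G b"
    and X: "midpoint_free X" "\<And>z. \<exists>u\<in>X. \<exists>v\<in>X. z = u + v"
  defines "A \<equiv> lin_comb G b ` {c. range c \<subseteq> X}"
  shows "tight_pair G A A"
proof -
  have b: "range b \<subseteq> carrier G"
    and coords: "\<And>x. x \<in> carrier G \<Longrightarrow> \<exists>c. x = lin_comb G b c"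
    using basis unfolding int_basis_lin_comb by blast+
  have sole: "sole_product G A A x x" if x: "x \<in> A" for x
  proof -
    obtain w where w: "range w \<subseteq> X" "x = lin_comb G b w"
      using x unfolding A_def by blast
    have "u = w \<and> v = w" if uv: "range u \<subseteq> X" "range v \<subseteq> X"
      and eq: "lin_comb G b u \<otimes> lin_comb G b v = x \<otimes> x" for u v
    proof -
      have "(\<lambda>i. u i + v i) = (\<lambda>i. w i + w i)"
        using eq inj_lin_comb[OF basis] unfolding w(2) lin_comb_add[OF b] by (simp add: inj_eq)
      then have sum: "u i + v i = 2 * w i" for i
        by (metis mult_2)
      have "u i = w i" for i
        using X(1) sum[of i] uv w(1) unfolding midpoint_free_def by blast
      with sum show ?thesis by (auto simp: fun_eq_iff)
    qed
    then show ?thesis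
      using x unfolding sole_product_def A_def by blast
  qed
  have "\<exists>x\<in>A. \<exists>y\<in>A. g = x \<otimes> y" if g: "g \<in> carrier G" for g
  proof -
    obtain c where c: "g = lin_comb G b c" using coords g by blast
    have "\<exists>u\<in>X. z - u \<in> X" for z
      using X(2) by (metis add_diff_cancel_left')
    then obtain p where p: "\<And>z. p z \<in> X" "\<And>z. z - p z \<in> X" by metis
    define u v where "u i = p (c i)" and "v i = c i - p (c i)" for i
    then have uv: "\<And>i. u i \<in> X" "\<And>i. v i \<in> X" "\<And>i. c i = u i + v i"
      using p by auto
    then have "g = lin_comb G b u \<otimes> lin_comb G b v"
      unfolding c lin_comb_add[OF b] by metis
    then show ?thesis
      using uv unfolding A_def by blast
  qed
  then show ?thesis
    using sole lin_comb_closed[OF b] unfolding tight_pair_def A_def by blast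
qed

definition coord_map :: "int ^ 'k ^ 'k \<Rightarrow> ('k::finite \<Rightarrow> int) \<Rightarrow> 'k \<Rightarrow> int" where
  "coord_map T c i = (\<Sum>j\<in>UNIV. T $ i $ j * c j)"

lemma (in comm_group) hom_lin_comb:
  fixes b :: "2 \<Rightarrow> 'a"
  assumes b: "range b \<subseteq> carrier G" and f: "f \<in> hom G G" and T: "has_matrix G b f T"
  shows "f (lin_comb G b c) = lin_comb G b (coord_map T c)"
proof -
  have bG [simp]: "b i \<in> carrier G" for i using b by blast
  have two: "(\<Otimes>i\<in>UNIV. b i [^] e i) = b 1 [^] e 1 \<otimes> b 2 [^] e 2" for e :: "2 \<Rightarrow> int"
    unfolding UNIV_2 by (subst finprod_insert) auto
  have fb: "f (b j) = b 1 [^] (T $ 1 $ j) \<otimes> b 2 [^] (T $ 2 $ j)" for j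
    using T unfolding has_matrix_def two by blast
  have "f (lin_comb G b c) = f (b 1) [^] c 1 \<otimes> f (b 2) [^] c 2"
    unfolding lin_comb_def two by (simp add: hom_mult[OF f] hom_int_pow[OF f] is_group)
  also have "\<dots> = b 1 [^] (T $ 1 $ 1 * c 1) \<otimes> b 2 [^] (T $ 2 $ 1 * c 1)
      \<otimes> (b 1 [^] (T $ 1 $ 2 * c 2) \<otimes> b 2 [^] (T $ 2 $ 2 * c 2))"
    unfolding fb by (simp add: int_pow_distrib int_pow_pow)
  also have "\<dots> = lin_comb G b (coord_map T c)"
    unfolding lin_comb_def two coord_map_def sum_2 by (simp add: int_pow_mult m_ac)
  finally show ?thesis .
qed

text \<open>
  A signed permutation matrix is orthogonal, so its transpose inverts it; both permute coordinates
  up to sign and hence preserve the condition that all coordinates lie in a symmetric set.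
\<close>

lemma coord_map_signed_perms2:
  assumes T: "T \<in> signed_perms2" and X: "uminus ` X = X"
  shows "inj (coord_map T)" "coord_map T ` {c. range c \<subseteq> X} = {c. range c \<subseteq> X}"
proof -
  have neg: "- x \<in> X" if "x \<in> X" for x
    using that X by blast
  have T': "T$1$2 = 0 \<and> T$2$1 = 0 \<and> T$1$1 \<in> {1, -1} \<and> T$2$2 \<in> {1, -1} \<or>
      T$1$1 = 0 \<and> T$2$2 = 0 \<and> T$1$2 \<in> {1, -1} \<and> T$2$1 \<in> {1, -1}"
    using T unfolding signed_perms2_def by (elim insertE emptyE) simp_all
  have box: "range c \<subseteq> X \<longleftrightarrow> c 1 \<in> X \<and> c 2 \<in> X" for c :: "2 \<Rightarrow> int"
    unfolding UNIV_2 by auto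
  have left_inv: "coord_map (transpose T) (coord_map T c) = c"
    and right_inv: "coord_map T (coord_map (transpose T) c) = c" for c
    using T' by (auto simp: fun_eq_iff forall_2 coord_map_def sum_2 transpose_def)
  have maps: "range (coord_map T c) \<subseteq> X" "range (coord_map (transpose T) c) \<subseteq> X"
    if "range c \<subseteq> X" for c
    using T' that unfolding box coord_map_def sum_2 transpose_def
    by (elim disjE conjE insertE emptyE; simp add: neg)+
  show "inj (coord_map T)"
    using left_inv by (metis injI)
  show "coord_map T ` {c. range c \<subseteq> X} = {c. range c \<subseteq> X}"
    using maps right_inv by (auto simp: image_iff) metis
qed

lemma (in comm_group) int_basis_of_free_of_rank_1:
  assumes "free_of_rank G 1"
  obtains b :: "1 \<Rightarrow> 'a" where "int_basis G b"
proof -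
  have "integer_group \<cong> free_Abelian_group {..<1::nat}"
    using isomorphic_group_integer_free_Abelian_group_singleton[of "0::nat"]
    by (simp add: lessThan_Suc)
  then obtain h where h: "h \<in> iso integer_group G"
    using assms iso_trans unfolding free_of_rank_def is_iso_def by blast
  have h1: "h 1 \<in> carrier G"
    using h by (auto simp: iso_def hom_def Pi_iff)
  have bij: "bij_betw h UNIV (carrier G)"
    using h by (simp add: iso_def)
  have pow: "h 1 [^] n = h n" for n :: int
    using hom_int_pow[of h integer_group G 1 n] h is_group
    by (simp add: iso_def)
  have comb: "lin_comb G (\<lambda>_::1. h 1) c = h (c 1)" for c
    unfolding lin_comb_def UNIV_1 using bij by (simp add: pow bij_betw_apply)
  have "\<exists>!c :: 1 \<Rightarrow> int. x = h (c 1)" if x: "x \<in> carrier G" for x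
  proof -
    obtain n where "x = h n" using bij x by (auto simp: bij_betw_def)
    moreover have "inj h" using bij by (simp add: bij_betw_def)
    ultimately show ?thesis
      by (intro ex1I[of _ "\<lambda>_. n"]) (simp_all add: fun_eq_iff inj_eq forall_1)
  qed
  then have "int_basis G (\<lambda>_::1. h 1)"
    unfolding int_basis_lin_comb comb using h1 by auto
  then show ?thesis by (rule that)
qed

lemma (in comm_group) trivial_of_free_of_rank_0:
  assumes "free_of_rank G 0"
  shows "carrier G = {\<one>}"
proof -
  obtain h where h: "h \<in> iso (free_Abelian_group ({} :: nat set)) G"
    using assms unfolding free_of_rank_def is_iso_def by auto
  have "carrier (free_Abelian_group ({} :: nat set)) = {0}"
    by (auto simp: free_Abelian_group_def)
  then have "\<exists>x. carrier G = {x}"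
    using h by (auto simp: iso_def bij_betw_def)
  then show ?thesis by (metis one_closed singletonD)
qed

text \<open>
  In all three ranks the set found satisfies \<open>f ` A = A\<close>. The conclusion is phrased with \<open>f ` A\<close>
  because that form, together with injectivity on \<open>A\<close>, is what an extension step consumes; the
  sets obtained after an extension are in general no longer invariant.
\<close>

lemma (in comm_group) tight_pair_rank_le_2:
  assumes rank: "\<exists>k\<le>2. free_of_rank G k" and f: "f \<in> hom G G"
    and rank1: "free_of_rank G 1 \<Longrightarrow> \<forall>x\<in>carrier G. f x = x"
    and rank2: "free_of_rank G 2 \<Longrightarrow> \<exists>(b :: 2 \<Rightarrow> 'a) T. int_basis G b \<and> T \<in> signed_perms2 \<and> has_matrix G b f T"
  shows "\<exists>A. tight_pair G A (f ` A) \<and> inj_on f A"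
proof -
  obtain X where X: "uminus ` X = X" "midpoint_free X" "\<And>z. \<exists>u\<in>X. \<exists>v\<in>X. z = u + v"
    using symmetric_midpoint_free_basis by blast
  obtain k where "k \<le> 2" "free_of_rank G k"
    using rank by blast
  then consider "free_of_rank G 0" | "free_of_rank G 1" | "free_of_rank G 2"
    by (metis One_nat_def le_0_eq le_SucE numeral_2_eq_2)
  then show ?thesis
  proof cases
    case 1
    have "carrier G = {\<one>}" using 1 by (rule trivial_of_free_of_rank_0)
    moreover have "f \<one> = \<one>" using f by (simp add: hom_one is_group)
    ultimately show ?thesis
      by (intro exI[of _ "{\<one>}"]) (auto simp: tight_pair_def sole_product_def)
  next
    case 2
    obtain b :: "1 \<Rightarrow> 'a" where b: "int_basis G b"
      using int_basis_of_free_of_rank_1[OF 2] by blast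
    define A where "A = lin_comb G b ` {c. range c \<subseteq> X}"
    have tight: "tight_pair G A A"
      unfolding A_def using tight_pair_lin_combs[OF b X(2,3)] .
    then have id: "f x = x" if "x \<in> A" for x
      using rank1[OF 2] that unfolding tight_pair_def by blast
    then have "f ` A = A" "inj_on f A"
      by (auto simp: inj_on_def)
    with tight show ?thesis by metis
  next
    case 3
    obtain b :: "2 \<Rightarrow> 'a" and T where b: "int_basis G b" and T: "T \<in> signed_perms2"
      and fT: "has_matrix G b f T"
      using rank2[OF 3] by blast
    define A where "A = lin_comb G b ` {c. range c \<subseteq> X}"
    have tight: "tight_pair G A A"
      unfolding A_def using tight_pair_lin_combs[OF b X(2,3)] .
    have rb: "range b \<subseteq> carrier G"
      using b unfolding int_basis_def by blast
    note f_comb = hom_lin_comb[OF rb f fT]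
    have "f ` A = lin_comb G b ` coord_map T ` {c. range c \<subseteq> X}"
      unfolding A_def image_image f_comb ..
    then have "f ` A = A"
      unfolding A_def coord_map_signed_perms2(2)[OF T X(1)] .
    moreover have "inj_on f A"
      unfolding A_def inj_on_def ball_simps f_comb
      using inj_lin_comb[OF b] coord_map_signed_perms2(1)[OF T X(1)] by (simp add: inj_eq)
    ultimately show ?thesis using tight by metis
  qed
qed

section \<open>Induction along the filtration\<close>

lemma comm_group_int_lattice: "comm_group int_lattice"
proof (rule comm_groupI)
  fix x :: "int ^ 'n"
  assume "x \<in> carrier int_lattice"
  show "\<exists>y\<in>carrier int_lattice. y \<otimes>\<^bsub>int_lattice\<^esub> x = \<one>\<^bsub>int_lattice\<^esub>"
    by (rule bexI[of _ "- x"]) (auto simp: int_lattice_def)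
qed (auto simp: int_lattice_def)

text \<open>
  The union that defines \<open>induced_map\<close> is formed in the ambient group \<open>G\<close>, while the extension step
  takes place in \<open>M (Suc i)\<close>; both compute cosets with the same multiplication.
\<close>

lemma (in comm_group) tight_pair_filtration:
  assumes f: "f \<in> hom G G" and sub: "\<And>i. i \<le> r \<Longrightarrow> subgroup (M i) G"
    and M0: "M 0 = {\<one>}" and mono: "\<And>i. i < r \<Longrightarrow> M i \<subseteq> M (Suc i)"
    and stable: "\<And>i. i \<le> r \<Longrightarrow> f ` M i \<subseteq> M i"
    and step: "\<And>i. i < r \<Longrightarrow> \<exists>A. tight_pair (G\<lparr>carrier := M (Suc i)\<rparr> Mod M i) A (induced_map G f (M i) ` A)
                 \<and> inj_on (induced_map G f (M i)) A"
  shows "i \<le> r \<Longrightarrow> \<exists>A. tight_pair (G\<lparr>carrier := M i\<rparr>) A (f ` A)"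
proof (induction i)
  case 0
  have "f \<one> = \<one>" using f by (simp add: hom_one is_group)
  then show ?case
    by (intro exI[of _ "{\<one>}"]) (auto simp: tight_pair_def sole_product_def M0)
next
  case (Suc i)
  then obtain AN where AN: "tight_pair (G\<lparr>carrier := M i\<rparr>) AN (f ` AN)"
    by auto
  let ?K = "G\<lparr>carrier := M (Suc i)\<rparr>"
  interpret K: comm_group ?K
    using Suc.prems sub by (intro comm_group_subgroup) auto
  obtain AQ where AQ: "tight_pair (?K Mod M i) AQ (induced_map G f (M i) ` AQ)"
    "inj_on (induced_map G f (M i)) AQ"
    using step[of i] Suc.prems by auto
  have MG: "M (Suc i) \<subseteq> carrier G"
    using sub[OF Suc.prems] subgroup.subset by blast
  show ?case
  proof (rule K.tight_pair_image_extension[where N = "M i" and AN = AN and AQ = AQ])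
    show "subgroup (M i) ?K"
      using sub[of i] sub[of "Suc i"] mono[of i] Suc.prems by (intro subgroup_incl) auto
    show "f \<in> hom ?K ?K"
      using f stable[OF Suc.prems] by (auto simp: hom_def Pi_iff subsetD[OF MG])
    show "f ` M i \<subseteq> M i" using stable[of i] Suc.prems by simp
    show "inj_on (induced_map G f (M i)) AQ" by fact
    show "tight_pair (?K\<lparr>carrier := M i\<rparr>) AN (f ` AN)" using AN by simp
    show "tight_pair (?K Mod M i) AQ (induced_map G f (M i) ` AQ)" by fact
    fix x assume "x \<in> carrier ?K"
    then show "induced_map G f (M i) (M i #>\<^bsub>?K\<^esub> x) = M i #>\<^bsub>?K\<^esub> f x"
      using induced_map_coset[OF is_group sub[of i] f stable[of i], of x] Suc.prems MG
      by (auto simp: r_coset_def)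
  qed
qed

theorem theorem4p3:
  fixes \<sigma> :: "int ^ 'n \<Rightarrow> int ^ 'n"
    and M :: "nat \<Rightarrow> (int ^ 'n) set"
    and r :: nat
  defines "G \<equiv> (int_lattice :: (int ^ 'n) monoid)"
  defines "Q \<equiv> \<lambda>i. G\<lparr>carrier := M (Suc i)\<rparr> Mod M i"
  defines "\<sigma>Q \<equiv> \<lambda>i. induced_map G \<sigma> (M i)"
  assumes "\<sigma> \<in> iso G G"
    and "\<And>i. i \<le> r \<Longrightarrow> subgroup (M i) G"
    and "M 0 = {0}" and "M r = UNIV"
    and "\<And>i. i < r \<Longrightarrow> M i \<subset> M (Suc i)"
    and "\<And>i. i \<le> r \<Longrightarrow> \<sigma> ` M i \<subseteq> M i"
    and "\<And>i. i < r \<Longrightarrow> \<exists>k\<le>2. free_of_rank (Q i) k"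
    and "\<And>i. i < r \<Longrightarrow> free_of_rank (Q i) 1 \<Longrightarrow> \<forall>C\<in>carrier (Q i). \<sigma>Q i C = C"
    and "\<And>i. i < r \<Longrightarrow> free_of_rank (Q i) 2 \<Longrightarrow>
           \<exists>(b :: 2 \<Rightarrow> (int ^ 'n) set) T. int_basis (Q i) b \<and> T \<in> signed_perms2 \<and>
             has_matrix (Q i) b (\<sigma>Q i) T"
  shows "\<exists>A. co_minimal_pair G A (\<sigma> ` A)"
proof -
  interpret comm_group G
    unfolding G_def by (rule comm_group_int_lattice)
  have hom: "\<sigma> \<in> hom G G" using assms(4) by (simp add: iso_def)
  have G_eq: "G\<lparr>carrier := M r\<rparr> = G" and one: "\<one>\<^bsub>G\<^esub> = 0"
    unfolding assms(7) by (simp_all add: G_def int_lattice_def)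
  have "\<exists>A. tight_pair (Q i) A (\<sigma>Q i ` A) \<and> inj_on (\<sigma>Q i) A" if i: "i < r" for i
  proof -
    let ?K = "G\<lparr>carrier := M (Suc i)\<rparr>"
    interpret K: comm_group ?K
      using i assms(5) by (intro comm_group_subgroup) auto
    have sub: "subgroup (M i) ?K"
      using assms(5)[of i] assms(5)[of "Suc i"] assms(8)[of i] i by (intro subgroup_incl) auto
    interpret N: normal "M i" ?K
      using sub by (rule K.subgroup_imp_normal)
    interpret Q: comm_group "Q i"
      unfolding Q_def using sub by (rule K.abelian_FactGroup)
    have MG: "M (Suc i) \<subseteq> carrier G"
      using assms(5)[of "Suc i"] i subgroup.subset by fastforce
    have on_coset: "\<sigma>Q i (M i #>\<^bsub>?K\<^esub> x) = M i #>\<^bsub>?K\<^esub> \<sigma> x" if "x \<in> M (Suc i)" for x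
      unfolding \<sigma>Q_def
      using induced_map_coset[OF is_group assms(5)[of i] hom assms(9)[of i], of x] i that MG
      by (auto simp: r_coset_def)
    have \<sigma>M: "\<sigma> x \<in> M (Suc i)" if "x \<in> M (Suc i)" for x
      using assms(9)[of "Suc i"] i that by auto
    have "\<sigma>Q i \<in> hom (Q i) (Q i)"
    proof (rule homI)
      fix C assume "C \<in> carrier (Q i)"
      then obtain x where x: "x \<in> M (Suc i)" "C = M i #>\<^bsub>?K\<^esub> x"
        unfolding Q_def FactGroup_def RCOSETS_def by auto
      then show "\<sigma>Q i C \<in> carrier (Q i)"
        using on_coset \<sigma>M unfolding Q_def FactGroup_def RCOSETS_def by auto
      fix D assume "D \<in> carrier (Q i)"
      then obtain y where y: "y \<in> M (Suc i)" "D = M i #>\<^bsub>?K\<^esub> y"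
        unfolding Q_def FactGroup_def RCOSETS_def by auto
      have "x \<otimes>\<^bsub>G\<^esub> y \<in> M (Suc i)"
        using x y K.m_closed by simp
      moreover have "\<sigma> (x \<otimes>\<^bsub>G\<^esub> y) = \<sigma> x \<otimes>\<^bsub>G\<^esub> \<sigma> y"
        using x y MG hom by (auto simp: hom_def)
      ultimately show "\<sigma>Q i (C \<otimes>\<^bsub>Q i\<^esub> D) = \<sigma>Q i C \<otimes>\<^bsub>Q i\<^esub> \<sigma>Q i D"
        using x y on_coset \<sigma>M N.rcos_sum
        unfolding Q_def FactGroup_def by simp
    qed
    then show ?thesis
      using assms(10-12) i by (intro Q.tight_pair_rank_le_2) blast+
  qed
  moreover have "M i \<subseteq> M (Suc i)" if "i < r" for i
    using assms(8)[OF that] by blast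
  ultimately have "\<exists>A. tight_pair (G\<lparr>carrier := M r\<rparr>) A (\<sigma> ` A)"
    using assms(5,6,9) hom one
    by (intro tight_pair_filtration[where M = M and r = r]) (auto simp: Q_def \<sigma>Q_def)
  then show ?thesis
    unfolding G_eq using tight_pair_imp_co_minimal_pair is_monoid by blast
qed

end
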